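(* There are five triples $(a,b,d)$, corresponding to $\nu=(\nu_0,\nu_1,\nu_\infty)=(\frac1a,\frac1b,\frac2d)$ (with $\pi:\mathbb{P}^1\to\mathbb{P}^1$ of degree $d$, $r_0=a$, $r_1=b$), which satisfy the assumptions below: $$(3,2,12),\quad(4,2,8),\quad(6,2,6),\quad(3,3,6),\quad(4,4,4).$$ The assumptions are: (1) $T=\{0,1,\infty\}$; (2) $\nu$, the monodromy data defining the Deligne–Mostow local system $l_T\to\mathbb{P}^1\setminus T$, satisfies $\sum_j\nu_j=1$; (3) $\pi$ satisfies property $G$; (4) $\mu$ is the monodromy data of the pull-back local system $\pi^*l_T$, such that: (a) $S=\pi^{-1}(\infty)$, that is, $\mu_i\notin\mathbb{Z}$ precisely for $s_i\in\pi^{-1}(\infty)$; (b) the sum of the non-integral $\mu_i$ equals $2$; (c) if $m$ is the lowest common denominator of the $\mu_i$, the ring of integers in $\mathbb{Q}(\zeta_m)$ is either $\mathbb{Z}[\sqrt{-1}]$ or $\mathbb{Z}[\omega]$ ($\omega$ a primitive cube root of unity); (d) $\mu$ satisfies condition $INT$ or $\Sigma INT$.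
   Context: $l_T$ is the rank-1 complex local system on $\mathbb{P}^1\setminus T$ with monodromy $e^{2\pi i\nu_t}$ around $t\in T$, the $\nu_t$ being rational numbers in $(0,1)$. The pull-back $\pi^*l_T$ on $\mathbb{P}^1\setminus\pi^{-1}(T)$ has monodromy data $r\nu_t$ at a point over $t$ with ramification index $r$ (local monodromy $e^{2\pi i r\nu_t}$); $S\subset\pi^{-1}(T)$ is the set of points with nontrivial local monodromy. $(\pi,T)$ has property $G$ if for each $t\in T$ all points of $\pi^{-1}(t)$ have the same ramification index, denoted $r_t$. $\zeta_m$ is a primitive $m$-th root of unity. Conditions $INT$ and $\Sigma INT$ concern the list of the $\mu_i$ attached to points of $S$, with $0<\mu_i<1$, $\sum\mu_i=2$. $INT$: whenever $s\neq t$ and $\mu_s+\mu_t<1$, $(1-\mu_s-\mu_t)^{-1}\in\mathbb{Z}$. $\Sigma INT$: for a subset $S_1$ of the indices with all $\mu_s$ ($s\in S_1$) equal, whenever $s\ne t$ and $\mu_s+\mu_t<1$, $(1-\mu_s-\mu_t)^{-1}$ lies in $\frac12\mathbb{Z}$ if $s,t\in S_1$, and in $\mathbb{Z}$ otherwise.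
   Formalization: For (4,4,4) all μ_i are 1/2, so m = 2 and the ring is Z, violating (c); so (c) is relaxed to "contained in Z[√-1] or Z[ω]" for the five triples, and with (c) verbatim exactly the other four are shown to remain. Triples are normalized by b ≤ a (swapping 0 and 1). *)

theory Defs
  imports "HOL-Analysis.Analysis" "HOL-Computational_Algebra.Computational_Algebra"
begin

section \<open>Self-maps of the projective line\<close>

datatype P1 = Pt complex | Infty

text \<open>
  A pair \<open>(P, Q)\<close> of coprime polynomials, not both constant, stands for the nonconstant morphism
  \<open>P/Q\<close> of the complex projective line, i.e. for the pair of homogeneous forms of degree
  \<open>max (degree P) (degree Q)\<close> obtained from \<open>P\<close> and \<open>Q\<close>.
\<close>

type_synonym rational_map = "complex poly \<times> complex poly"

fun map_degree :: "rational_map \<Rightarrow> nat" where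
  "map_degree (P, Q) = max (degree P) (degree Q)"

fun nonconstant_map :: "rational_map \<Rightarrow> bool" where
  "nonconstant_map (P, Q) \<longleftrightarrow> coprime P Q \<and> 0 < map_degree (P, Q)"

fun map_eval :: "rational_map \<Rightarrow> P1 \<Rightarrow> P1" where
  "map_eval (P, Q) (Pt z) = (if poly Q z = 0 then Infty else Pt (poly P z / poly Q z))"
| "map_eval (P, Q) Infty =
     (let d = map_degree (P, Q)
      in if coeff Q d = 0 then Infty else Pt (coeff P d / coeff Q d))"

definition fibre :: "rational_map \<Rightarrow> P1 \<Rightarrow> P1 set" where
  "fibre \<pi> t = {s. map_eval \<pi> s = t}"

fun fibre_poly :: "rational_map \<Rightarrow> P1 \<Rightarrow> complex poly" where
  "fibre_poly (P, Q) (Pt w) = P - smult w Q"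
| "fibre_poly (P, Q) Infty = Q"

text \<open>
  The ramification index at \<open>s\<close> is the order of vanishing at \<open>s\<close> of the homogeneous form, of degree
  the degree of the map, that cuts out the fibre through \<open>s\<close>. At infinity this order is the drop in
  degree of the dehomogenised polynomial.
\<close>

fun ram_index :: "rational_map \<Rightarrow> P1 \<Rightarrow> nat" where
  "ram_index \<pi> (Pt z) = order z (fibre_poly \<pi> (map_eval \<pi> (Pt z)))"
| "ram_index \<pi> Infty = map_degree \<pi> - degree (fibre_poly \<pi> (map_eval \<pi> Infty))"

definition uniform_ramification :: "rational_map \<Rightarrow> P1 \<Rightarrow> nat \<Rightarrow> bool" where
  "uniform_ramification \<pi> t r \<longleftrightarrow> (\<forall>s\<in>fibre \<pi> t. ram_index \<pi> s = r)"

definition property_G :: "rational_map \<Rightarrow> P1 set \<Rightarrow> bool" where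
  "property_G \<pi> T \<longleftrightarrow> (\<forall>t\<in>T. \<exists>r. uniform_ramification \<pi> t r)"


section \<open>Monodromy data\<close>

text \<open>
  A rank-1 local system on the complement of the finite set \<open>T\<close> is determined by its local
  monodromies, which may be any nonzero numbers of product 1; it is represented by exponents
  \<open>\<nu> t\<close> with local monodromy \<open>exp (2\<pi>i \<nu> t)\<close>. Only the values on \<open>T\<close> matter.
\<close>

definition local_monodromy :: "rat \<Rightarrow> complex" where
  "local_monodromy q = cis (2 * pi * of_rat q)"

definition preimage_pts :: "rational_map \<Rightarrow> P1 set \<Rightarrow> P1 set" where
  "preimage_pts \<pi> T = {s. map_eval \<pi> s \<in> T}"

definition pullback_data :: "rational_map \<Rightarrow> (P1 \<Rightarrow> rat) \<Rightarrow> P1 \<Rightarrow> rat" where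
  "pullback_data \<pi> \<nu> s = of_nat (ram_index \<pi> s) * \<nu> (map_eval \<pi> s)"

definition singular_pts :: "rational_map \<Rightarrow> P1 set \<Rightarrow> (P1 \<Rightarrow> rat) \<Rightarrow> P1 set" where
  "singular_pts \<pi> T \<nu> =
     {s \<in> preimage_pts \<pi> T. local_monodromy (pullback_data \<pi> \<nu> s) \<noteq> 1}"

definition weights :: "'a set \<Rightarrow> ('a \<Rightarrow> rat) \<Rightarrow> bool" where
  "weights S \<mu> \<longleftrightarrow> finite S \<and> (\<forall>s\<in>S. 0 < \<mu> s \<and> \<mu> s < 1) \<and> (\<Sum>s\<in>S. \<mu> s) = 2"

definition cond_INT :: "'a set \<Rightarrow> ('a \<Rightarrow> rat) \<Rightarrow> bool" where
  "cond_INT S \<mu> \<longleftrightarrow> weights S \<mu> \<and>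
     (\<forall>s\<in>S. \<forall>t\<in>S. s \<noteq> t \<and> \<mu> s + \<mu> t < 1 \<longrightarrow> inverse (1 - \<mu> s - \<mu> t) \<in> \<int>)"

definition cond_Sigma_INT :: "'a set \<Rightarrow> ('a \<Rightarrow> rat) \<Rightarrow> bool" where
  "cond_Sigma_INT S \<mu> \<longleftrightarrow> weights S \<mu> \<and>
     (\<exists>S1\<subseteq>S. (\<forall>s\<in>S1. \<forall>t\<in>S1. \<mu> s = \<mu> t) \<and>
        (\<forall>s\<in>S. \<forall>t\<in>S. s \<noteq> t \<and> \<mu> s + \<mu> t < 1 \<longrightarrow>
           (if s \<in> S1 \<and> t \<in> S1 then 2 * inverse (1 - \<mu> s - \<mu> t) \<in> \<int>
            else inverse (1 - \<mu> s - \<mu> t) \<in> \<int>)))"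


section \<open>Cyclotomic fields and their rings of integers\<close>

definition lowest_common_denominator :: "'a set \<Rightarrow> ('a \<Rightarrow> rat) \<Rightarrow> nat" where
  "lowest_common_denominator S \<mu> = (LEAST m. 0 < m \<and> (\<forall>s\<in>S. of_nat m * \<mu> s \<in> \<int>))"

definition complex_subfield :: "complex set \<Rightarrow> bool" where
  "complex_subfield K \<longleftrightarrow> 0 \<in> K \<and> 1 \<in> K \<and>
     (\<forall>x\<in>K. \<forall>y\<in>K. x - y \<in> K \<and> x * y \<in> K) \<and> (\<forall>x\<in>K. inverse x \<in> K)"

definition cyclotomic_field :: "nat \<Rightarrow> complex set" where
  "cyclotomic_field m = \<Inter> {K. complex_subfield K \<and> cis (2 * pi / real m) \<in> K}"

definition ring_of_integers :: "complex set \<Rightarrow> complex set" where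
  "ring_of_integers K = {x \<in> K. algebraic_int x}"

definition Z_adjoin :: "complex \<Rightarrow> complex set" where
  "Z_adjoin \<alpha> = range (\<lambda>p :: int poly. poly (map_poly of_int p) \<alpha>)"

definition gaussian_integers :: "complex set" where
  "gaussian_integers = Z_adjoin \<i>"

definition eisenstein_integers :: "complex set" where
  "eisenstein_integers = Z_adjoin (cis (2 * pi / 3))"


section \<open>The assumptions on the covering and the local system\<close>

text \<open>
  For \<open>R\<close> equality, the ring of integers of the cyclotomic field is one of the two rings; for \<open>R\<close>
  inclusion, it is contained in one of them. They differ when the field is that of the
  rational numbers, e.g. if all the weights are \<open>1/2\<close>.
\<close>

definition ring_condition ::
  "(complex set \<Rightarrow> complex set \<Rightarrow> bool) \<Rightarrow> 'a set \<Rightarrow> ('a \<Rightarrow> rat) \<Rightarrow> bool" where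
  "ring_condition R S \<mu> \<longleftrightarrow>
     (let A = ring_of_integers (cyclotomic_field (lowest_common_denominator S \<mu>))
      in R A gaussian_integers \<or> R A eisenstein_integers)"

definition pullback_assumptions ::
  "(complex set \<Rightarrow> complex set \<Rightarrow> bool) \<Rightarrow> rational_map \<Rightarrow> P1 set \<Rightarrow> (P1 \<Rightarrow> rat) \<Rightarrow> bool" where
  "pullback_assumptions R \<pi> T \<nu> \<longleftrightarrow>
     nonconstant_map \<pi> \<and>
     T = {Pt 0, Pt 1, Infty} \<and>
     (\<forall>t\<in>T. 0 < \<nu> t \<and> \<nu> t < 1) \<and> (\<Sum>t\<in>T. \<nu> t) = 1 \<and>
     property_G \<pi> T \<and>
     (let \<mu> = pullback_data \<pi> \<nu>; S = singular_pts \<pi> T \<nu> in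
        S = fibre \<pi> Infty \<and>
        (\<Sum>s\<in>{s \<in> preimage_pts \<pi> T. \<mu> s \<notin> \<int>}. \<mu> s) = 2 \<and>
        ring_condition R S \<mu> \<and>
        (cond_INT S \<mu> \<or> cond_Sigma_INT S \<mu>))"

definition admissible_triple ::
  "(complex set \<Rightarrow> complex set \<Rightarrow> bool) \<Rightarrow> nat \<Rightarrow> nat \<Rightarrow> nat \<Rightarrow> bool" where
  "admissible_triple R a b d \<longleftrightarrow>
     (\<exists>\<pi> T \<nu>. pullback_assumptions R \<pi> T \<nu> \<and>
        map_degree \<pi> = d \<and>
        uniform_ramification \<pi> (Pt 0) a \<and> uniform_ramification \<pi> (Pt 1) b \<and>
        \<nu> (Pt 0) = 1 / of_nat a \<and> \<nu> (Pt 1) = 1 / of_nat b \<and> \<nu> Infty = 2 / of_nat d)"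

end

theory Submission
  imports Defs
begin

text \<open>
  The orders of vanishing over \<open>0\<close> sum to the degree, so \<open>a dvd d\<close>; together with
  \<open>1 / a + 1 / b + 2 / d = 1\<close> and \<open>b \<le> a\<close> this already leaves only the five triples. For
  \<open>(4, 4, 4)\<close> the weights lie in \<open>(1 / 2) \<int>\<close>, hence are all \<open>1 / 2\<close>, and the cyclotomic field is that of
  the rational numbers, whose ring of integers is neither of the two rings.

  Conversely, each triple is realised by \<open>\<pi> = p ^ a / (p ^ a - q ^ b)\<close> with coprime squarefree \<open>p\<close>
  and \<open>q\<close> for which \<open>p ^ a - q ^ b\<close> is squarefree as well. The map is then unramified over
  infinity, so there are \<open>d\<close> weights, all equal to \<open>2 / d\<close>, and the condition \<open>\<Sigma>INT\<close> with \<open>S1 = S\<close>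
  amounts to \<open>2 d / (d - 4)\<close> being an integer when \<open>d > 4\<close>.
\<close>

section \<open>The numerical equation\<close>

text \<open>Writing \<open>d = a * k\<close> and clearing denominators turns the equation into
  \<open>b * k + a * k + 2 * b = a * b * k\<close>. Since \<open>b \<le> a\<close>, this forces
  \<open>k * (b - 1) \<le> k + 2\<close>, which leaves only a few values of \<open>b\<close> and
  \<open>k\<close>.\<close>

lemma triple_cases:
  fixes a b d :: nat
  assumes "b \<le> a" "a dvd d" "2 \<le> b" "0 < d"
    and eq: "1 / of_nat a + 1 / of_nat b + 2 / of_nat d = (1::rat)"
  shows "(a, b, d) \<in> {(3, 2, 12), (4, 2, 8), (6, 2, 6), (3, 3, 6), (4, 4, 4)}"
proof -
  obtain k where k: "d = a * k" using assms by (auto elim: dvdE)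
  have "rat_of_nat (b * k + a * k + 2 * b) = of_nat (a * b * k)"
    using eq assms by (simp add: k field_simps)
  then have E: "b * k + a * k + 2 * b = a * b * k"
    using of_nat_eq_iff by blast
  have kpos: "0 < k" using assms k by auto
  have B: "k * b \<le> 2 * k + 2"
  proof -
    have "a * (k * (b - 1)) + a * k = a * b * k"
      using assms by (cases b) (auto simp: algebra_simps)
    then have "a * (k * (b - 1)) = b * (k + 2)" using E by (simp add: algebra_simps)
    moreover have "b * (k * (b - 1)) \<le> a * (k * (b - 1))" using assms by simp
    ultimately have "b * (k * (b - 1)) \<le> b * (k + 2)" by simp
    then have "k * (b - 1) \<le> k + 2" using assms(3) by (subst (asm) mult_le_cancel1) linarith
    then show ?thesis using assms by (cases b) (auto simp: algebra_simps)
  qed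
  have "b \<le> 4"
  proof (rule ccontr)
    assume "\<not> b \<le> 4"
    then have "k * 5 \<le> k * b" by (intro mult_le_mono) auto
    with B kpos show False by linarith
  qed
  then consider "b = 2" | "b = 3" | "b = 4" using assms by linarith
  then show ?thesis
  proof cases
    case 1
    \<comment> \<open>Equivalently \<open>k * (a - 2) = 4\<close>: the divisors 1, 2, 4 of 4 give
      \<open>a\<close> = 6, 4, 3.\<close>
    have E1: "k * a = 2 * k + 4" using E 1 by (simp add: algebra_simps)
    then have "k dvd 4" by (metis dvd_add_right_iff dvd_triv_left dvd_triv_right)
    then have "k \<le> 4" by (simp add: dvd_imp_le)
    then have "k = 1 \<or> k = 2 \<or> k = 3 \<or> k = 4" using kpos by linarith
    moreover have "k \<noteq> 3"
    proof
      assume "k = 3"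
      with \<open>k dvd 4\<close> show False by simp
    qed
    ultimately show ?thesis using E1 1 k by auto
  next
    case 2
    \<comment> \<open>Here the equation reads \<open>2 * a * k = 3 * k + 6\<close>; parity excludes
      \<open>k = 1\<close>, where it would say \<open>2 * a = 9\<close>.\<close>
    then have "k = 1 \<or> k = 2" using B kpos by (auto; presburger)
    moreover have "k \<noteq> 1"
    proof
      assume "k = 1"
      with E 2 have "9 + a = 3 * a" by simp
      then show False by presburger
    qed
    ultimately have "k = 2" by simp
    with E 2 k show ?thesis by simp
  next
    case 3
    then have "k = 1" using B kpos by simp
    with E 3 k show ?thesis by simp
  qed
qed

section \<open>Ramification and weights\<close>

text \<open>The ramification indices over a point sum to the degree of the map, and here they all
  equal \<open>r\<close>. The finite points of the fibre are the roots of \<open>F\<close>; infinity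
  accounts for a possible drop in degree.\<close>

lemma uniform_ramification_dvd_degree:
  assumes "nonconstant_map \<pi>" "uniform_ramification \<pi> (Pt w) r"
  shows "r dvd map_degree \<pi>"
proof -
  obtain P Q where \<pi>: "\<pi> = (P, Q)" by (cases \<pi>)
  define F where "F = P - smult w Q"
  define d where "d = max (degree P) (degree Q)"
  have cop: "coprime P Q" and d0: "0 < d" using assms by (auto simp: \<pi> d_def)
  have F0: "F \<noteq> 0"
  \<comment> \<open>A vanishing \<open>F\<close> would make \<open>P\<close> a multiple of
    \<open>Q\<close>, so by coprimality both would be constant.\<close>
  proof
    assume "F = 0"
    then have PQ: "P = smult w Q" by (simp add: F_def)
    then have "Q dvd P" by (simp add: dvd_smult)
    then have "is_unit Q" using cop by (metis coprime_common_divisor dvd_refl)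
    then have "degree Q = 0" by (auto simp: is_unit_poly_iff)
    with PQ d0 show False by (simp add: d_def split: if_splits)
  qed
  have "order z F = r" if "poly F z = 0" for z
  proof -
    have "poly P z = w * poly Q z" using that by (simp add: F_def)
    with coprime_poly_0[OF cop, of z] have "poly Q z \<noteq> 0" by auto
    with \<open>poly P z = w * poly Q z\<close> have ev: "map_eval \<pi> (Pt z) = Pt w" by (simp add: \<pi>)
    then have "ram_index \<pi> (Pt z) = r"
      using assms(2) by (simp only: uniform_ramification_def fibre_def mem_Collect_eq)
    then have "order z (fibre_poly \<pi> (Pt w)) = r" using ev by (simp only: ram_index.simps)
    then show ?thesis by (simp add: \<pi> F_def)
  qed
  \<comment> \<open>Over the complex numbers the orders of the roots sum to the degree of
    \<open>F\<close>.\<close>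
  then have "r dvd size (proots F)"
    unfolding size_multiset_overloaded_eq using F0 by (intro dvd_sum) auto
  then have rF: "r dvd degree F" by (simp add: size_proots_complex)
  show ?thesis
  proof (cases "degree F = d")
    case True
    with rF show ?thesis by (simp add: \<pi> d_def)
  next
    case False
    \<comment> \<open>When the degree of \<open>F\<close> drops below \<open>d\<close>, infinity
      lies in the fibre and its index is the drop, so \<open>d = degree F + r\<close>.\<close>
    have le: "degree F \<le> d"
      unfolding F_def d_def by (meson degree_diff_le degree_smult_le max.cobounded1 max.cobounded2 order_trans)
    then have "coeff F d = 0" using False by (intro coeff_eq_0) auto
    then have PQ: "coeff P d = w * coeff Q d" by (simp add: F_def)
    have "coeff Q d \<noteq> 0"
    proof
      assume "coeff Q d = 0"
      with PQ have "coeff P d = 0" by simp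
      with \<open>coeff Q d = 0\<close> d0 show False
        by (auto simp: d_def max_def leading_coeff_0_iff split: if_splits)
    qed
    with PQ have ev: "map_eval \<pi> Infty = Pt w" by (simp add: \<pi> Let_def flip: d_def)
    then have "ram_index \<pi> Infty = r"
      using assms(2) by (simp only: uniform_ramification_def fibre_def mem_Collect_eq)
    then have "map_degree \<pi> - degree (fibre_poly \<pi> (Pt w)) = r"
      using ev by (simp only: ram_index.simps)
    then have "d - degree F = r" by (simp add: \<pi> F_def d_def)
    with rF le have "r dvd d" by (metis dvd_add dvd_refl le_add_diff_inverse)
    then show ?thesis by (simp add: \<pi> d_def)
  qed
qed

text \<open>Identifies the points of nontrivial monodromy with those of nonintegral
  exponent.\<close>

lemma local_monodromy_eq_1_iff: "local_monodromy q = 1 \<longleftrightarrow> q \<in> \<int>"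
proof
  assume "local_monodromy q = 1"
  then have "cos (2 * pi * of_rat q) = 1"
    unfolding local_monodromy_def by (metis cis.simps(1) one_complex.simps(1))
  then obtain n :: int where "2 * pi * real_of_rat q = of_int n * 2 * pi"
    using cos_one_2pi_int by auto
  then have "real_of_rat q = real_of_rat (of_int n)" by simp
  then show "q \<in> \<int>" by (metis Ints_of_int of_rat_eq_iff)
next
  assume "q \<in> \<int>"
  then obtain n where "q = of_int n" by (auto elim: Ints_cases)
  then show "local_monodromy q = 1" by (simp add: local_monodromy_def cis_multiple_2pi)
qed

text \<open>If \<open>k / m\<close> is an integer, then \<open>m\<close> divides \<open>k\<close>.
  Constant weights \<open>1 / m\<close> occur when the covering is unramified over infinity.\<close>

lemma lowest_common_denominator_const:
  assumes "S \<noteq> {}" "\<And>s. s \<in> S \<Longrightarrow> \<mu> s = 1 / of_nat m" "0 < m"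
  shows "lowest_common_denominator S \<mu> = m"
  unfolding lowest_common_denominator_def
proof (rule Least_equality)
  show "0 < m \<and> (\<forall>s\<in>S. rat_of_nat m * \<mu> s \<in> \<int>)" using assms by simp
next
  fix k assume k: "0 < k \<and> (\<forall>s\<in>S. rat_of_nat k * \<mu> s \<in> \<int>)"
  then obtain n where "rat_of_nat k / of_nat m = of_int n"
    using assms by (fastforce elim: Ints_cases)
  then have "rat_of_int (int k) = of_int (n * int m)" using assms by (simp add: field_simps)
  then have "int k = n * int m" using of_int_eq_iff by blast
  then have "m dvd k" by (metis dvd_triv_right int_dvd_int_iff)
  with k show "m \<le> k" by (simp add: dvd_imp_le)
qed

section \<open>Roots of squarefree complex polynomials\<close>

text \<open>Raising to the power \<open>n\<close> multiplies the order of every root by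
  \<open>n\<close>, and the roots of \<open>p\<close> are simple. This makes the ramification of
  \<open>p ^ a\<close> over 0 uniform.\<close>

lemma order_power_rsquarefree:
  fixes p :: "complex poly"
  assumes "rsquarefree p" "poly p z = 0"
  shows "order z (p ^ n) = n"
proof -
  have "p \<noteq> 0" using assms by (simp add: rsquarefree_def)
  then have "order z (p ^ n) = count (proots (p ^ n)) z" by simp
  also have "\<dots> = n * order z p" using \<open>p \<noteq> 0\<close> by (simp add: proots_power)
  finally show ?thesis using assms \<open>p \<noteq> 0\<close> by (simp add: rsquarefree_root_order)
qed

lemma card_roots_rsquarefree:
  fixes p :: "complex poly"
  assumes "rsquarefree p"
  shows "card {z. poly p z = 0} = degree p"
proof -
  have "p \<noteq> 0" using assms by (simp add: rsquarefree_def)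
  then have "degree p = (\<Sum>z\<in>{z. poly p z = 0}. order z p)"
    by (simp add: size_multiset_overloaded_eq flip: size_proots_complex)
  also have "\<dots> = (\<Sum>z\<in>{z. poly p z = 0}. 1)"
    using assms \<open>p \<noteq> 0\<close> by (intro sum.cong) (auto simp: rsquarefree_root_order)
  finally show ?thesis by simp
qed

text \<open>A common divisor of positive degree would have a complex root, shared by
  \<open>p\<close> and \<open>q\<close>.\<close>

lemma coprimeI_no_common_root:
  fixes p q :: "complex poly"
  assumes "p \<noteq> 0" "\<And>z. poly p z = 0 \<Longrightarrow> poly q z \<noteq> 0"
  shows "coprime p q"
proof (rule coprimeI)
  fix c assume c: "c dvd p" "c dvd q"
  have "degree c = 0"
    using c assms by (metis alg_closed_imp_poly_has_root dvd_trans gr0I poly_eq_0_iff_dvd)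
  then show "is_unit c" using c assms by (metis dvd_0_left is_unit_iff_degree)
qed

section \<open>Rings of integers of cyclotomic fields of degree at most two\<close>

text \<open>
  Gauss's lemma: pseudo-division by the primitive part \<open>g\<close> of the quadratic shows that \<open>g\<close> divides
  a monic integer polynomial over the integers, so its leading coefficient is a unit.
\<close>

lemma quadratic_algebraic_int_dvd:
  fixes z :: complex
  assumes "algebraic_int z" "z \<notin> \<real>" "A \<noteq> 0"
    and eq: "of_int A * z\<^sup>2 + of_int B * z + of_int C = 0"
  shows "A dvd B" "A dvd C"
proof -
  let ?ev = "\<lambda>p :: int poly. poly (map_poly of_int p) z"
  obtain P :: "int poly" where P: "?ev P = 0" "lead_coeff P = 1"
    using assms(1) by (auto simp: algebraic_int_altdef_ipoly)
  define F where "F = [:C, B, A:]"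
  define g where "g = primitive_part F"
  have F: "F = smult (content F) g" by (simp add: g_def)
  have degF: "degree F = 2" using assms(3) by (simp add: F_def)
  then have "F \<noteq> 0" by auto
  with degF have g: "g \<noteq> 0" "degree g = 2" "content g = 1"
    by (simp_all add: g_def)
  have cF: "content F \<noteq> 0" using degF by auto
  have "?ev F = 0" using eq by (simp add: F_def map_poly_pCons power2_eq_square algebra_simps)
  then have evg: "?ev g = 0" using cF by (subst (asm) F) (simp add: map_poly_smult)
  obtain q r where qr: "pseudo_divmod P g = (q, r)" by (cases "pseudo_divmod P g")
  define K where "K = lead_coeff g ^ (Suc (degree P) - degree g)"
  have PK: "smult K P = g * q + r" and r: "r = 0 \<or> degree r < 2"
    using pseudo_divmod[OF g(1) qr] g(2) by (auto simp: K_def)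
  have add: "?ev (p + p') = ?ev p + ?ev p'" for p p'
  proof -
    have "map_poly of_int (p + p') = map_poly of_int p + (map_poly of_int p' :: complex poly)"
      by (intro poly_eqI) (simp add: coeff_map_poly)
    then show ?thesis by simp
  qed
  have smult: "?ev (smult c p) = of_int c * ?ev p" for c p
    by (simp add: map_poly_smult)
  have hom: "?ev (p * p') = ?ev p * ?ev p'" for p p'
    by (induction p) (simp_all add: add smult map_poly_pCons algebra_simps)
  have "?ev r = 0" using arg_cong[OF PK, of ?ev] P evg by (simp add: hom add smult)
  have "r = 0"
  \<comment> \<open>A nonzero remainder has degree at most 1 and vanishes at \<open>z\<close>, which
    would make \<open>z\<close> rational and hence real.\<close>
  proof (rule ccontr)
    assume "r \<noteq> 0"
    then have "degree r \<le> 1" using r by auto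
    have "r = [:coeff r 0, coeff r 1:]"
      using \<open>degree r \<le> 1\<close>
      by (intro poly_eqI) (auto simp: coeff_pCons coeff_eq_0 split: nat.splits)
    then obtain u v where uv: "r = [:u, v:]" by blast
    have 0: "of_int u + of_int v * z = 0" using \<open>?ev r = 0\<close> by (simp add: uv map_poly_pCons mult.commute)
    have "v = 0"
    proof (rule ccontr)
      assume "v \<noteq> 0"
      then have "z = - of_int u / of_int v" using 0 by (simp add: field_simps add_eq_0_iff)
      then have "z \<in> \<real>" by simp
      with assms show False by simp
    qed
    with 0 uv \<open>r \<noteq> 0\<close> show False by simp
  qed
  have "content P = 1" using P(2) by (metis content_dvd_coeff normalize_content normalize_1_iff is_unit_normalize)
  have "K \<noteq> 0" using g(1) by (simp add: K_def leading_coeff_0_iff del: One_nat_def)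
  \<comment> \<open>Content is multiplicative, and both \<open>P\<close> (monic) and
    \<open>g\<close> are primitive. So the factor \<open>K\<close> introduced by pseudo-division
    divides \<open>q\<close> and can be cancelled, leaving \<open>P = g * q'\<close>.\<close>
  have "normalize K = content q"
    using arg_cong[OF PK, of content] \<open>content P = 1\<close> g \<open>r = 0\<close> by (simp add: content_mult)
  then have "K dvd content q" by (metis dvd_refl dvd_normalize_iff)
  then obtain t where "content q = K * t" by (auto elim: dvdE)
  then have q': "q = smult K (smult t (primitive_part q))"
    by (metis content_times_primitive_part smult_smult)
  define q' where "q' = smult t (primitive_part q)"
  have "smult K P = smult K (g * q')" using PK \<open>r = 0\<close> q'[folded q'_def] by simp
  then have "P = g * q'" using \<open>K \<noteq> 0\<close> by (intro poly_eqI) (auto simp: poly_eq_iff simp del: coeff_mult)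
  then have "lead_coeff g * lead_coeff q' = 1" using P(2) by (metis lead_coeff_mult)
  then have "lead_coeff g dvd 1" by (metis dvd_triv_left)
  \<comment> \<open>As \<open>lead_coeff g\<close> is a unit, \<open>A\<close> agrees with the
    content of \<open>F\<close> up to sign, and the content divides every coefficient.\<close>
  then have "content F * lead_coeff g dvd content F" by (simp add: mult_dvd_mono)
  moreover have "content F * lead_coeff g = A"
    using arg_cong[OF F, of lead_coeff] assms(3) by (simp add: F_def lead_coeff_smult del: One_nat_def)
  ultimately have "A dvd content F" by simp
  moreover have "content F dvd coeff F 1" "content F dvd coeff F 0" by auto
  ultimately show "A dvd B" "A dvd C" by (auto simp: F_def dest: dvd_trans)
qed

section \<open>Imaginary quadratic fields in coordinates\<close>

text \<open>The field generated by \<open>\<alpha>\<close> when \<open>\<alpha>\<close> is quadratic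
  over the rationals; explicit coordinates allow denominators to be cleared.\<close>

definition quad_field :: "complex \<Rightarrow> complex set" where
  "quad_field \<alpha> = {of_rat x + of_rat y * \<alpha> | x y. True}"

text \<open>The relation covers \<open>\<i>\<close> with \<open>e = 0\<close> and the primitive cube
  root of unity with \<open>e = 1\<close>. It reduces products to the span of 1 and
  \<open>\<alpha>\<close>; inverses come from the conjugate divided by the norm.\<close>

lemma complex_subfield_quad_field:
  assumes \<alpha>: "\<alpha>\<^sup>2 = - of_int e * \<alpha> - 1" and im: "\<alpha> \<notin> \<real>"
  shows "complex_subfield (quad_field \<alpha>)"
proof -
  have mem: "of_rat x + of_rat y * \<alpha> \<in> quad_field \<alpha>" for x y
    by (auto simp: quad_field_def)
  have 1: "0 \<in> quad_field \<alpha>" "1 \<in> quad_field \<alpha>"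
    using mem[of 0 0] mem[of 1 0] by auto
  have 2: "u - v \<in> quad_field \<alpha> \<and> u * v \<in> quad_field \<alpha>" if uv: "u \<in> quad_field \<alpha>" "v \<in> quad_field \<alpha>" for u v
  proof -
    obtain x y where u: "u = of_rat x + of_rat y * \<alpha>" using uv(1) by (auto simp: quad_field_def)
    obtain x' y' where v: "v = of_rat x' + of_rat y' * \<alpha>" using uv(2) by (auto simp: quad_field_def)
    have "u - v = of_rat (x - x') + of_rat (y - y') * \<alpha>"
      by (simp add: u v of_rat_diff algebra_simps)
    moreover have "u * v = of_rat (x * x' - y * y') + of_rat (x * y' + y * x' - of_int e * y * y') * \<alpha>"
    proof -
      have "u * v = of_rat x * of_rat x' + (of_rat x * of_rat y' + of_rat y * of_rat x') * \<alpha>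
              + of_rat y * of_rat y' * \<alpha>\<^sup>2"
        by (simp add: u v power2_eq_square algebra_simps)
      then show ?thesis
        unfolding \<alpha> by (simp add: of_rat_diff of_rat_add of_rat_mult algebra_simps)
    qed
    ultimately show ?thesis using mem by metis
  qed
  have 3: "inverse u \<in> quad_field \<alpha>" if u: "u \<in> quad_field \<alpha>" for u
  proof (cases "u = 0")
    case True
    with 1 show ?thesis by simp
  next
    case False
    obtain x y where u: "u = of_rat x + of_rat y * \<alpha>" using u by (auto simp: quad_field_def)
    \<comment> \<open>The other root of the quadratic is \<open>- e - \<alpha>\<close>, so
      \<open>v\<close> is the conjugate of \<open>u\<close> and \<open>N\<close> is its
      norm.\<close>
    define N where "N = x\<^sup>2 - of_int e * x * y + y\<^sup>2"
    define v where "v = of_rat (x - of_int e * y) + of_rat (- y) * \<alpha>"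
    have uv: "u * v = of_rat N"
    proof -
      have "u * v = of_rat x * (of_rat x - of_int e * of_rat y) - of_int e * (of_rat y)\<^sup>2 * \<alpha> - (of_rat y)\<^sup>2 * \<alpha>\<^sup>2"
        by (simp add: u v_def of_rat_diff of_rat_mult of_rat_minus power2_eq_square algebra_simps)
      also have "\<dots> = of_rat N"
        unfolding \<alpha> by (simp add: N_def of_rat_diff of_rat_add of_rat_mult power2_eq_square algebra_simps)
      finally show ?thesis .
    qed
    \<comment> \<open>Since \<open>\<alpha>\<close> is not real, 1 and \<open>\<alpha>\<close> are
      independent over the rationals.\<close>
    have "v \<noteq> 0"
    proof
      assume v0: "v = 0"
      have "y = 0"
      proof (rule ccontr)
        assume "y \<noteq> 0"
        then have "\<alpha> = of_rat ((x - of_int e * y) / y)"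
          using v0 by (simp add: v_def of_rat_minus of_rat_divide field_simps)
        then have "\<alpha> \<in> \<rat>" by simp
        then show False using im by (auto elim!: Rats_cases')
      qed
      with v0 have "x = 0" by (simp add: v_def)
      with \<open>y = 0\<close> u False show False by simp
    qed
    then have "N \<noteq> 0" using uv False by auto
    then have "inverse u = v / of_rat N" using uv False by (simp add: field_simps)
    also have "\<dots> = of_rat ((x - of_int e * y) / N) + of_rat (- y / N) * \<alpha>"
      by (simp only: v_def of_rat_divide add_divide_distrib times_divide_eq_left)
    finally show ?thesis using mem by metis
  qed
  show ?thesis unfolding complex_subfield_def using 1 2 3 by blast
qed

section \<open>Subfields of the complex numbers and cyclotomic fields\<close>

lemma cyclotomic_field_subset:
  assumes "complex_subfield K" "cis (2 * pi / real m) \<in> K"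
  shows "cyclotomic_field m \<subseteq> K"
  using assms by (auto simp: cyclotomic_field_def)

lemma complex_subfield_cyclotomic_field: "complex_subfield (cyclotomic_field m)"
  by (auto simp: cyclotomic_field_def complex_subfield_def)

lemma cis_in_cyclotomic_field: "cis (2 * pi / real m) \<in> cyclotomic_field m"
  by (auto simp: cyclotomic_field_def)

lemma complex_subfield_diff: "complex_subfield K \<Longrightarrow> x \<in> K \<Longrightarrow> y \<in> K \<Longrightarrow> x - y \<in> K"
  by (simp add: complex_subfield_def)

lemma complex_subfield_add:
  assumes "complex_subfield K" "x \<in> K" "y \<in> K"
  shows "x + y \<in> K"
proof -
  have "0 - y \<in> K" using assms unfolding complex_subfield_def by blast
  then have "x - (0 - y) \<in> K" using assms unfolding complex_subfield_def by blast
  then show ?thesis by simp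
qed

lemma complex_subfield_of_int:
  assumes "complex_subfield K"
  shows "of_int n \<in> K"
proof -
  have nat: "of_nat k \<in> K" for k
  proof (induction k)
    case 0
    then show ?case using assms by (simp add: complex_subfield_def)
  next
    case (Suc k)
    then show ?case
      using complex_subfield_add[OF assms, of 1 "of_nat k"] assms by (simp add: complex_subfield_def)
  qed
  show ?thesis
  proof (cases n)
    case (nonneg k)
    with nat show ?thesis by simp
  next
    case (neg k)
    have "0 - of_nat (Suc k) \<in> K" using nat assms unfolding complex_subfield_def by blast
    then show ?thesis by (simp add: neg)
  qed
qed

section \<open>Rings generated by a quadratic integer\<close>

text \<open>By induction on the polynomial in Horner form, each new square of
  \<open>\<alpha>\<close> is replaced by an integral combination of 1 and
  \<open>\<alpha>\<close>.\<close>

lemma Z_adjoin_quadratic: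
  assumes \<alpha>: "\<alpha>\<^sup>2 = - of_int e * \<alpha> - 1"
  shows "Z_adjoin \<alpha> = {of_int u + of_int v * \<alpha> | u v. True}"
proof (intro equalityI subsetI)
  fix x assume "x \<in> Z_adjoin \<alpha>"
  then obtain p :: "int poly" where "x = poly (map_poly of_int p) \<alpha>"
    by (auto simp: Z_adjoin_def)
  moreover have "\<exists>u v. poly (map_poly of_int p) \<alpha> = of_int u + of_int v * \<alpha>"
  proof (induction p)
    case 0
    have "poly (map_poly of_int 0) \<alpha> = of_int 0 + of_int 0 * \<alpha>" by simp
    then show ?case by blast
  next
    case (pCons c p)
    then obtain u v where uv: "poly (map_poly of_int p) \<alpha> = of_int u + of_int v * \<alpha>" by blast
    have "poly (map_poly of_int (pCons c p)) \<alpha> = of_int c + of_int u * \<alpha> + of_int v * \<alpha>\<^sup>2"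
      by (simp add: map_poly_pCons uv power2_eq_square algebra_simps)
    also have "\<dots> = of_int (c - v) + of_int (u - e * v) * \<alpha>"
      unfolding \<alpha> by (simp add: algebra_simps)
    finally show ?case by blast
  qed
  ultimately show "x \<in> {of_int u + of_int v * \<alpha> | u v. True}" by blast
next
  fix x assume "x \<in> {of_int u + of_int v * \<alpha> | u v. True}"
  then obtain u v where "x = of_int u + of_int v * \<alpha>" by blast
  then have "x = poly (map_poly of_int [:u, v:]) \<alpha>" by (simp add: map_poly_pCons mult.commute)
  then show "x \<in> Z_adjoin \<alpha>" unfolding Z_adjoin_def by blast
qed

lemma self_in_Z_adjoin: "\<alpha> \<in> Z_adjoin \<alpha>"
  unfolding Z_adjoin_def by (rule image_eqI[of _ _ "[:0, 1:]"]) (simp_all add: map_poly_pCons)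

lemma Z_adjoin_subset_ring_of_integers:
  assumes \<alpha>: "\<alpha>\<^sup>2 = - of_int e * \<alpha> - 1" and K: "complex_subfield K" "\<alpha> \<in> K"
  shows "Z_adjoin \<alpha> \<subseteq> ring_of_integers K"
proof
  fix x assume "x \<in> Z_adjoin \<alpha>"
  then obtain u v where x: "x = of_int u + of_int v * \<alpha>"
    using Z_adjoin_quadratic[OF \<alpha>] by blast
  have "of_int v * \<alpha> \<in> K"
    using K complex_subfield_of_int[OF K(1)] by (simp add: complex_subfield_def)
  then have "x \<in> K" using K complex_subfield_of_int[OF K(1)] by (simp add: x complex_subfield_add)
  moreover have "algebraic_int x"
  proof (rule algebraic_int.intros)
    \<comment> \<open>The characteristic polynomial of \<open>u + v * \<alpha>\<close>, with trace
      \<open>2 * u - e * v\<close> and norm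
      \<open>u\<^sup>2 - e * u * v + v\<^sup>2\<close>.\<close>
    let ?p = "[:of_int (u\<^sup>2 - e * u * v + v\<^sup>2), of_int (e * v - 2 * u), 1:] :: complex poly"
    show "lead_coeff ?p = 1" by simp
    show "\<forall>i. coeff ?p i \<in> \<int>" by (auto simp: coeff_pCons split: nat.splits)
    have "poly ?p x = of_int v ^ 2 * (\<alpha>\<^sup>2 + of_int e * \<alpha> + 1)"
      by (simp add: x power2_eq_square algebra_simps)
    also have "\<dots> = 0" unfolding \<alpha> by simp
    finally show "poly ?p x = 0" .
  qed
  ultimately show "x \<in> ring_of_integers K" by (simp add: ring_of_integers_def)
qed

section \<open>Integrality through trace and norm\<close>

lemma quad_field_common_denominator:
  assumes "x \<in> quad_field \<alpha>"
  obtains a b c :: int where "0 < c" "x = (of_int a + of_int b * \<alpha>) / of_int c"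
proof -
  obtain r s where x: "x = of_rat r + of_rat s * \<alpha>" using assms by (auto simp: quad_field_def)
  obtain a1 c1 where 1: "r = of_int a1 / of_int c1" "0 < c1" by (metis quotient_of_div quotient_of_denom_pos surj_pair)
  obtain a2 c2 where 2: "s = of_int a2 / of_int c2" "0 < c2" by (metis quotient_of_div quotient_of_denom_pos surj_pair)
  show ?thesis
  proof
    show "0 < c1 * c2" using 1 2 by simp
    show "x = (of_int (a1 * c2) + of_int (a2 * c1) * \<alpha>) / of_int (c1 * c2)"
      using 1(2) 2(2) unfolding x 1(1) 2(1) by (simp add: of_rat_divide add_divide_distrib)
  qed
qed

text \<open>The trace \<open>(2 * a - e * b) / c\<close> and the norm
  \<open>(a\<^sup>2 - e * a * b + b\<^sup>2) / c\<^sup>2\<close> of a nonreal integer are integers: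
  multiplying its quadratic equation by \<open>c\<^sup>2\<close> gives integer coefficients that the
  leading one must divide.\<close>

lemma quad_field_integral_trace_norm:
  fixes \<alpha> x :: complex
  assumes \<alpha>: "\<alpha>\<^sup>2 = - of_int e * \<alpha> - 1" "\<alpha> \<notin> \<real>"
    and x: "algebraic_int x" "x = (of_int a + of_int b * \<alpha>) / of_int c" "0 < c" "b \<noteq> 0"
  shows "c dvd 2 * a - e * b" "c\<^sup>2 dvd a\<^sup>2 - e * a * b + b\<^sup>2"
proof -
  have cx: "of_int c * x = of_int a + of_int b * \<alpha>" using x by simp
  have "x \<notin> \<real>"
  proof
    assume "x \<in> \<real>"
    have "\<alpha> = (of_int c * x - of_int a) / of_int b" using cx x(4) by simp
    also have "\<dots> \<in> \<real>"
      using \<open>x \<in> \<real>\<close> by (intro Reals_divide Reals_diff Reals_mult) auto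
    finally show False using \<alpha>(2) by simp
  qed
  moreover have "of_int (c\<^sup>2) * x\<^sup>2 + of_int (- (2 * a - e * b) * c) * x + of_int (a\<^sup>2 - e * a * b + b\<^sup>2) = 0"
  proof -
    have "of_int (c\<^sup>2) * x\<^sup>2 + of_int (- (2 * a - e * b) * c) * x + of_int (a\<^sup>2 - e * a * b + b\<^sup>2)
        = (of_int c * x)\<^sup>2 - of_int (2 * a - e * b) * (of_int c * x) + of_int (a\<^sup>2 - e * a * b + b\<^sup>2)"
      by (simp add: power_mult_distrib algebra_simps)
    also have "\<dots> = of_int b ^ 2 * (\<alpha>\<^sup>2 + of_int e * \<alpha> + 1)"
      unfolding cx by (simp add: power2_eq_square algebra_simps)
    also have "\<dots> = 0" unfolding \<alpha>(1) by simp
    finally show ?thesis .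
  qed
  moreover have "c\<^sup>2 \<noteq> 0" using x(3) by simp
  ultimately have *: "c\<^sup>2 dvd - (2 * a - e * b) * c" "c\<^sup>2 dvd a\<^sup>2 - e * a * b + b\<^sup>2"
    using quadratic_algebraic_int_dvd[OF x(1)] by blast+
  from *(1) have "c dvd - (2 * a - e * b)"
    using x(3) by (simp only: power2_eq_square dvd_mult_cancel_right) simp
  then show "c dvd 2 * a - e * b" by (simp only: dvd_minus_iff)
  show "c\<^sup>2 dvd a\<^sup>2 - e * a * b + b\<^sup>2" by (rule *(2))
qed

lemma gaussian_integers_eq: "gaussian_integers = {of_int u + of_int v * \<i> | u v. True}"
  unfolding gaussian_integers_def by (rule Z_adjoin_quadratic[where e = 0]) simp

lemma omega_square: "(cis (2 * pi / 3))\<^sup>2 = - of_int 1 * cis (2 * pi / 3) - 1"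
  by (simp add: complex_eq_iff power2_eq_square cos_120 sin_120)

lemma omega_not_real: "cis (2 * pi / 3) \<notin> \<real>"
  by (simp add: complex_is_Real_iff sin_120)

lemma eisenstein_integers_eq:
  "eisenstein_integers = {of_int u + of_int v * cis (2 * pi / 3) | u v. True}"
  unfolding eisenstein_integers_def by (rule Z_adjoin_quadratic[OF omega_square])

lemma algebraic_int_of_int_quotient_dvd:
  assumes "algebraic_int (of_int a / of_int c :: complex)" "c \<noteq> 0"
  shows "c dvd a"
proof -
  have "of_int a / of_int c \<in> (\<int> :: complex set)"
    using assms by (intro rational_algebraic_int_is_int) auto
  then obtain n where "of_int a / of_int c = (of_int n :: complex)" by (auto elim: Ints_cases)
  then have "(of_int a :: complex) = of_int (n * c)" using assms by (simp add: field_simps)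
  then show ?thesis using of_int_eq_iff by (metis dvd_triv_right)
qed

lemma ring_of_integers_quad_field_i: "ring_of_integers (quad_field \<i>) \<subseteq> gaussian_integers"
proof
  fix x assume "x \<in> ring_of_integers (quad_field \<i>)"
  then have x: "x \<in> quad_field \<i>" "algebraic_int x" by (auto simp: ring_of_integers_def)
  obtain a b c where c: "0 < c" and xc: "x = (of_int a + of_int b * \<i>) / of_int c"
    using quad_field_common_denominator[OF x(1)] by blast
  have "c dvd a \<and> c dvd b"
  proof (cases "b = 0")
    case True
    then show ?thesis using algebraic_int_of_int_quotient_dvd[of a c] x(2) xc c by simp
  next
    case False
    have "c dvd 2 * a - 0 * b" "c\<^sup>2 dvd a\<^sup>2 - 0 * a * b + b\<^sup>2"
      by (rule quad_field_integral_trace_norm[OF _ _ x(2) xc c False]; simp add: complex_is_Real_iff)+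
    then obtain u k where u: "2 * a = c * u" and k: "a\<^sup>2 + b\<^sup>2 = c\<^sup>2 * k" by (auto elim!: dvdE)
    \<comment> \<open>Four times the norm minus the square of the trace shows that \<open>c\<close>
      divides \<open>2 * b\<close>; what remains is to halve \<open>u\<close> and
      \<open>v\<close>.\<close>
    have "(2 * b)\<^sup>2 = 4 * (a\<^sup>2 + b\<^sup>2) - (2 * a)\<^sup>2" by (simp add: power2_eq_square algebra_simps)
    also have "\<dots> = c\<^sup>2 * (4 * k - u\<^sup>2)" unfolding u k by (simp add: power2_eq_square algebra_simps)
    finally have b2: "(2 * b)\<^sup>2 = c\<^sup>2 * (4 * k - u\<^sup>2)" .
    then have "c\<^sup>2 dvd (2 * b)\<^sup>2" by (metis dvd_triv_left)
    then have "c dvd 2 * b" using pow_divides_pow_iff[of 2 c "2 * b"] by (metis zero_less_numeral)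
    then obtain v where v: "2 * b = c * v" by (auto elim: dvdE)
    have "u\<^sup>2 + v\<^sup>2 = 4 * k" using b2 c unfolding v by (simp add: power_mult_distrib)
    \<comment> \<open>Modulo 4, a sum of two odd squares is 2, while
      \<open>u\<^sup>2 + v\<^sup>2\<close> is a multiple of 4.\<close>
    have "even u \<and> even v"
    proof (rule ccontr)
      assume "\<not> (even u \<and> even v)"
      moreover have "even (u\<^sup>2 + v\<^sup>2)" using \<open>u\<^sup>2 + v\<^sup>2 = 4 * k\<close> by simp
      ultimately have "odd u" "odd v" by auto
      then obtain m n where "u = 2 * m + 1" "v = 2 * n + 1" by (auto elim!: oddE)
      with \<open>u\<^sup>2 + v\<^sup>2 = 4 * k\<close> have "4 * (m * m + m + n * n + n) + 2 = 4 * k"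
        by (simp add: power2_eq_square algebra_simps)
      then show False by presburger
    qed
    then show ?thesis using u v by (auto elim!: evenE)
  qed
  then obtain u v where "a = c * u" "b = c * v" by (auto elim!: dvdE)
  then have "of_int a + of_int b * \<i> = of_int c * (of_int u + of_int v * \<i>)"
    by (simp add: algebra_simps)
  then have "x = of_int u + of_int v * \<i>" using xc c by simp
  then show "x \<in> gaussian_integers" by (auto simp: gaussian_integers_eq)
qed

lemma ring_of_integers_quad_field_omega:
  "ring_of_integers (quad_field (cis (2 * pi / 3))) \<subseteq> eisenstein_integers"
proof
  fix x assume "x \<in> ring_of_integers (quad_field (cis (2 * pi / 3)))"
  then have x: "x \<in> quad_field (cis (2 * pi / 3))" "algebraic_int x"
    by (auto simp: ring_of_integers_def)
  obtain a b c where c: "0 < c" and xc: "x = (of_int a + of_int b * cis (2 * pi / 3)) / of_int c"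
    using quad_field_common_denominator[OF x(1)] by blast
  have "c dvd a \<and> c dvd b"
  proof (cases "b = 0")
    case True
    then show ?thesis using algebraic_int_of_int_quotient_dvd[of a c] x(2) xc c by simp
  next
    case False
    have "c dvd 2 * a - 1 * b" "c\<^sup>2 dvd a\<^sup>2 - 1 * a * b + b\<^sup>2"
      by (rule quad_field_integral_trace_norm[OF omega_square omega_not_real x(2) xc c False])+
    then obtain u k where u: "2 * a - b = c * u" and k: "a\<^sup>2 - a * b + b\<^sup>2 = c\<^sup>2 * k"
      by (auto elim!: dvdE)
    \<comment> \<open>The same combination now yields three times a square. Multiplying by 3 makes
      it a full square, so \<open>c\<close> divides \<open>3 * b\<close>; the quotient
      \<open>w\<close> has square divisible by 3, so the factor 3 cancels again.\<close>
    have "3 * b\<^sup>2 = 4 * (a\<^sup>2 - a * b + b\<^sup>2) - (2 * a - b)\<^sup>2"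
      by (simp add: power2_eq_square algebra_simps)
    also have "\<dots> = c\<^sup>2 * (4 * k - u\<^sup>2)" unfolding u k by (simp add: power2_eq_square algebra_simps)
    finally have b2: "3 * b\<^sup>2 = c\<^sup>2 * (4 * k - u\<^sup>2)" .
    have "(3 * b)\<^sup>2 = 3 * (3 * b\<^sup>2)" by (simp add: power_mult_distrib)
    also have "\<dots> = c\<^sup>2 * (3 * (4 * k - u\<^sup>2))" unfolding b2 by (rule mult.left_commute)
    finally have b3: "(3 * b)\<^sup>2 = c\<^sup>2 * (3 * (4 * k - u\<^sup>2))" .
    then have "c\<^sup>2 dvd (3 * b)\<^sup>2" by (metis dvd_triv_left)
    then have "c dvd 3 * b" using pow_divides_pow_iff[of 2 c "3 * b"] by (metis zero_less_numeral)
    then obtain w where w: "3 * b = c * w" by (auto elim: dvdE)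
    have "w\<^sup>2 = 3 * (4 * k - u\<^sup>2)" using b3 c unfolding w by (simp add: power_mult_distrib)
    then have "3 dvd w\<^sup>2" by simp
    then have "3 dvd w" by (rule prime_dvd_power[rotated]) simp
    then obtain v where v: "w = 3 * v" by (auto elim: dvdE)
    have b: "b = c * v" using w v by simp
    have "3 * v\<^sup>2 = 4 * k - u\<^sup>2" using \<open>w\<^sup>2 = 3 * (4 * k - u\<^sup>2)\<close> unfolding v by (simp add: power_mult_distrib)
    \<comment> \<open>Parity now settles the remaining coordinate, as
      \<open>2 * a = c * (u + v)\<close>.\<close>
    then have "even (u\<^sup>2 + 3 * v\<^sup>2)" by simp
    then have "even (u + v)" by simp
    then obtain n where n: "u + v = 2 * n" by (rule evenE)
    have "2 * a = c * (u + v)" using u b by (simp add: algebra_simps)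
    then have "a = c * n" unfolding n by simp
    then show ?thesis using b by simp
  qed
  then obtain u v where "a = c * u" "b = c * v" by (auto elim!: dvdE)
  then have "of_int a + of_int b * cis (2 * pi / 3) = of_int c * (of_int u + of_int v * cis (2 * pi / 3))"
    by (simp add: algebra_simps)
  then have "x = of_int u + of_int v * cis (2 * pi / 3)" using xc c by simp
  then show "x \<in> eisenstein_integers" by (auto simp: eisenstein_integers_eq)
qed

section \<open>The cyclotomic fields for denominators 2, 3, 4 and 6\<close>

lemma ring_of_integers_mono: "K \<subseteq> L \<Longrightarrow> ring_of_integers K \<subseteq> ring_of_integers L"
  by (auto simp: ring_of_integers_def)

lemma mem_quad_field: "of_rat x + of_rat y * \<alpha> \<in> quad_field \<alpha>"
  by (auto simp: quad_field_def)

text \<open>The root of unity is -1, so the field lies in the rationals, whose algebraic integers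
  are the integers.\<close>

lemma ring_of_integers_cyclotomic_2: "ring_of_integers (cyclotomic_field 2) \<subseteq> \<int>"
proof -
  have "cyclotomic_field 2 \<subseteq> \<rat>"
    by (rule cyclotomic_field_subset) (auto simp: complex_subfield_def)
  then show ?thesis by (auto simp: ring_of_integers_def rational_algebraic_int_is_int)
qed

lemma ring_of_integers_cyclotomic_4: "ring_of_integers (cyclotomic_field 4) = gaussian_integers"
proof
  have sq: "\<i>\<^sup>2 = - of_int 0 * \<i> - 1" by simp
  have cis: "cis (2 * pi / real 4) = \<i>" by (simp add: cis_pi_half)
  have "cyclotomic_field 4 \<subseteq> quad_field \<i>"
  proof (rule cyclotomic_field_subset)
    show "complex_subfield (quad_field \<i>)"
      by (rule complex_subfield_quad_field[OF sq]) (simp add: complex_is_Real_iff)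
    show "cis (2 * pi / real 4) \<in> quad_field \<i>"
      unfolding cis using mem_quad_field[of 0 1 \<i>] by simp
  qed
  then show "ring_of_integers (cyclotomic_field 4) \<subseteq> gaussian_integers"
    using ring_of_integers_mono ring_of_integers_quad_field_i by blast
  show "gaussian_integers \<subseteq> ring_of_integers (cyclotomic_field 4)"
    unfolding gaussian_integers_def
    using Z_adjoin_subset_ring_of_integers[OF sq complex_subfield_cyclotomic_field]
      cis_in_cyclotomic_field[of 4] unfolding cis .
qed

text \<open>The shift by \<open>k\<close> treats third and sixth roots of unity together, since
  \<open>cis (pi / 3) = 1 + cis (2 * pi / 3)\<close>.\<close>

lemma ring_of_integers_cyclotomic_eisenstein:
  assumes "cis (2 * pi / real m) = of_int k + cis (2 * pi / 3)"
  shows "ring_of_integers (cyclotomic_field m) = eisenstein_integers"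
proof
  have "cyclotomic_field m \<subseteq> quad_field (cis (2 * pi / 3))"
  proof (rule cyclotomic_field_subset)
    show "complex_subfield (quad_field (cis (2 * pi / 3)))"
      by (rule complex_subfield_quad_field[OF omega_square omega_not_real])
    show "cis (2 * pi / real m) \<in> quad_field (cis (2 * pi / 3))"
      unfolding assms using mem_quad_field[of "of_int k" 1 "cis (2 * pi / 3)"] by simp
  qed
  then show "ring_of_integers (cyclotomic_field m) \<subseteq> eisenstein_integers"
    using ring_of_integers_mono ring_of_integers_quad_field_omega by blast
  have "cis (2 * pi / real m) - of_int k \<in> cyclotomic_field m"
    by (intro complex_subfield_diff complex_subfield_of_int cis_in_cyclotomic_field
        complex_subfield_cyclotomic_field)
  then have "cis (2 * pi / 3) \<in> cyclotomic_field m" unfolding assms by simp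
  then show "eisenstein_integers \<subseteq> ring_of_integers (cyclotomic_field m)"
    unfolding eisenstein_integers_def
    by (rule Z_adjoin_subset_ring_of_integers[OF omega_square complex_subfield_cyclotomic_field])
qed

lemma ring_of_integers_cyclotomic_3: "ring_of_integers (cyclotomic_field 3) = eisenstein_integers"
  by (rule ring_of_integers_cyclotomic_eisenstein[where k = 0]) simp

lemma ring_of_integers_cyclotomic_6: "ring_of_integers (cyclotomic_field 6) = eisenstein_integers"
  by (rule ring_of_integers_cyclotomic_eisenstein[where k = 1])
    (simp add: complex_eq_iff cos_60 sin_60 cos_120 sin_120)

section \<open>Maps from squarefree polynomials\<close>

text \<open>
  The map is \<open>p ^ a / h\<close>. The three degree conditions keep the point at infinity out of the fibres
  over \<open>0\<close>, \<open>1\<close> and infinity.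
\<close>

lemma admissible_tripleI:
  fixes p q h :: "complex poly"
  assumes h: "h = p ^ a - q ^ b"
    and deg: "a * degree p = d" "b * degree q = d" "degree h = d"
    and sqf: "rsquarefree p" "rsquarefree q" "rsquarefree h"
    and no_common: "\<And>z. poly p z = 0 \<Longrightarrow> poly q z \<noteq> 0"
    and d: "d = 2 * m" and ge2: "2 \<le> a" "2 \<le> b" "2 \<le> m"
    and sum1: "1 / of_nat a + 1 / of_nat b + 2 / of_nat d = (1::rat)"
    and SINT: "m = 2 \<or> m - 2 dvd 2 * m"
    and ring: "R (ring_of_integers (cyclotomic_field m)) gaussian_integers \<or>
      R (ring_of_integers (cyclotomic_field m)) eisenstein_integers"
  shows "admissible_triple R a b d"
proof -
  define P where "P = p ^ a"
  define \<pi> :: rational_map where "\<pi> = (P, h)"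
  define T where "T = {Pt 0, Pt 1, Infty}"
  \<comment> \<open>Only the values on \<open>T\<close> matter; at finite points other than 0 the
    value intended for \<open>Pt 1\<close> serves as the default.\<close>
  define \<nu> :: "P1 \<Rightarrow> rat" where
    "\<nu> = (\<lambda>t. case t of Pt z \<Rightarrow> (if z = 0 then 1 / of_nat a else 1 / of_nat b) | Infty \<Rightarrow> 2 / of_nat d)"
  have \<nu>: "\<nu> (Pt 0) = 1 / of_nat a" "\<nu> (Pt 1) = 1 / of_nat b" "\<nu> Infty = 1 / of_nat m"
    by (simp_all add: \<nu>_def d)
  have Ph: "P - h = q ^ b" by (simp add: P_def h)
  have nz: "p \<noteq> 0" "q \<noteq> 0" "h \<noteq> 0" using sqf by (auto simp: rsquarefree_def)
  have degP: "degree P = d" using deg nz by (simp add: P_def degree_power_eq)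
  have degq: "degree (q ^ b) = d" using deg nz by (simp add: degree_power_eq)
  have mdeg: "map_degree \<pi> = d" by (simp add: \<pi>_def degP deg)
  have lead: "coeff P d \<noteq> 0" "coeff h d \<noteq> 0" "coeff P d \<noteq> coeff h d"
  proof -
    show "coeff P d \<noteq> 0" using nz degP by (metis P_def leading_coeff_0_iff power_not_zero)
    show "coeff h d \<noteq> 0" using nz deg by (metis leading_coeff_0_iff)
    have "coeff (q ^ b) d \<noteq> 0" using nz degq by (metis leading_coeff_0_iff power_not_zero)
    then show "coeff P d \<noteq> coeff h d" unfolding Ph[symmetric] by simp
  qed
  have P_roots: "poly P z = 0 \<longleftrightarrow> poly p z = 0" for z using ge2 by (simp add: P_def)
  have Ph_roots: "poly P z = poly h z \<longleftrightarrow> poly q z = 0" for z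
  proof -
    have "poly P z - poly h z = poly q z ^ b" unfolding Ph[symmetric] poly_power[symmetric] by simp
    then show ?thesis using ge2 by (auto simp: power_0_left)
  qed
  \<comment> \<open>At a root of \<open>p\<close> the value of \<open>h\<close> is that of
    \<open>- (q ^ b)\<close>.\<close>
  have no_common': "poly h z \<noteq> 0" if "poly p z = 0" for z
    using that no_common[OF that] P_roots[of z] Ph_roots[of z] by auto
  have evInf: "map_eval \<pi> Infty = Pt (coeff P d / coeff h d)"
    using lead by (simp add: \<pi>_def degP deg)
  have ev0: "map_eval \<pi> s = Pt 0 \<longleftrightarrow> (\<exists>z. s = Pt z \<and> poly p z = 0)" for s
    using lead evInf no_common' by (cases s) (auto simp: \<pi>_def P_roots)
  have ev1: "map_eval \<pi> s = Pt 1 \<longleftrightarrow> (\<exists>z. s = Pt z \<and> poly q z = 0)" for s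
  proof (cases s)
    case (Pt z)
    have "poly h z \<noteq> 0" if "poly q z = 0"
      using that Ph_roots[of z] P_roots[of z] no_common[of z] by auto
    then show ?thesis using Pt Ph_roots[of z] by (auto simp: \<pi>_def)
  next
    case Infty
    then show ?thesis using lead evInf by auto
  qed
  have evI: "map_eval \<pi> s = Infty \<longleftrightarrow> (\<exists>z. s = Pt z \<and> poly h z = 0)" for s
    using evInf by (cases s) (auto simp: \<pi>_def)
  have ram0: "ram_index \<pi> s = a" if s: "map_eval \<pi> s = Pt 0" for s
  proof -
    obtain z where z: "s = Pt z" "poly p z = 0" using s ev0 by blast
    have "ram_index \<pi> s = order z (fibre_poly \<pi> (Pt 0))" using s z by (simp only: ram_index.simps)
    also have "\<dots> = order z (p ^ a)" by (simp add: \<pi>_def P_def)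
    finally show ?thesis using z sqf order_power_rsquarefree by metis
  qed
  have ram1: "ram_index \<pi> s = b" if s: "map_eval \<pi> s = Pt 1" for s
  proof -
    obtain z where z: "s = Pt z" "poly q z = 0" using s ev1 by blast
    have "ram_index \<pi> s = order z (fibre_poly \<pi> (Pt 1))" using s z by (simp only: ram_index.simps)
    also have "\<dots> = order z (q ^ b)" by (simp add: \<pi>_def Ph)
    finally show ?thesis using z sqf order_power_rsquarefree by metis
  qed
  have ramI: "ram_index \<pi> s = 1" if s: "map_eval \<pi> s = Infty" for s
  proof -
    obtain z where z: "s = Pt z" "poly h z = 0" using s evI by blast
    have "ram_index \<pi> s = order z (fibre_poly \<pi> Infty)" using s z by (simp only: ram_index.simps)
    also have "\<dots> = order z h" by (simp add: \<pi>_def)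
    finally show ?thesis using z sqf nz rsquarefree_root_order by metis
  qed
  define \<mu> where "\<mu> = pullback_data \<pi> \<nu>"
  \<comment> \<open>Over 0 and 1 the ramification index cancels the denominator of the exponent, so
    the monodromy becomes trivial there.\<close>
  have \<mu>0: "\<mu> s = 1" if "map_eval \<pi> s = Pt 0" for s
    using that ram0 ge2 by (simp add: \<mu>_def pullback_data_def \<nu>)
  have \<mu>1: "\<mu> s = 1" if "map_eval \<pi> s = Pt 1" for s
    using that ram1 ge2 by (simp add: \<mu>_def pullback_data_def \<nu>)
  have \<mu>I: "\<mu> s = 1 / of_nat m" if "map_eval \<pi> s = Infty" for s
    using that ramI by (simp add: \<mu>_def pullback_data_def \<nu>)
  have nonint: "1 / rat_of_nat m \<notin> \<int>"
  proof
    assume "1 / rat_of_nat m \<in> \<int>"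
    then obtain n where n: "1 / rat_of_nat m = of_int n" by (auto elim: Ints_cases)
    moreover have "0 < 1 / rat_of_nat m" "1 / rat_of_nat m < 1" using ge2 by simp_all
    ultimately show False by simp
  qed
  define S where "S = fibre \<pi> Infty"
  have S\<mu>: "\<mu> s = 1 / of_nat m" if "s \<in> S" for s using that \<mu>I by (simp add: S_def fibre_def)
  have nonint_pts: "{s \<in> preimage_pts \<pi> T. \<mu> s \<notin> \<int>} = S"
    using \<mu>0 \<mu>1 \<mu>I nonint by (auto simp: preimage_pts_def T_def S_def fibre_def)
  then have sing: "singular_pts \<pi> T \<nu> = S"
    by (simp add: singular_pts_def local_monodromy_eq_1_iff flip: \<mu>_def)
  have S_eq: "S = Pt ` {z. poly h z = 0}" by (auto simp: S_def fibre_def evI)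
  have cardS: "card S = d"
    unfolding S_eq using sqf deg by (subst card_image) (auto simp: inj_on_def card_roots_rsquarefree)
  have finS: "finite S" using cardS d ge2 by (intro card_ge_0_finite) simp
  have sumS: "(\<Sum>s\<in>S. \<mu> s) = 2"
  proof -
    have "(\<Sum>s\<in>S. \<mu> s) = (\<Sum>s\<in>S. 1 / of_nat m)" by (intro sum.cong) (auto simp: S\<mu>)
    then show ?thesis using cardS d ge2 by simp
  qed
  have weights: "weights S \<mu>" using finS sumS S\<mu> ge2 by (auto simp: weights_def)
  have Sigma: "cond_Sigma_INT S \<mu>"
    unfolding cond_Sigma_INT_def
  proof (intro conjI weights exI[of _ S] ballI impI subset_refl)
    show "\<mu> s = \<mu> t" if "s \<in> S" "t \<in> S" for s t using that by (simp add: S\<mu>)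
    fix s t assume st: "s \<in> S" "t \<in> S" "s \<noteq> t \<and> \<mu> s + \<mu> t < 1"
    \<comment> \<open>For \<open>m = 2\<close> two weights already sum to 1, so the condition is
      vacuous.\<close>
    then have "m \<noteq> 2" by (auto simp: S\<mu>)
    with SINT ge2 have m: "2 < m" "m - 2 dvd 2 * m" by auto
    then obtain k where "2 * m = (m - 2) * k" by (auto elim: dvdE)
    then have "rat_of_nat (2 * m) = of_nat ((m - 2) * k)" by presburger
    then have k: "2 * rat_of_nat m = (of_nat m - 2) * of_nat k" using m by (simp add: of_nat_diff)
    have "2 * inverse (1 - \<mu> s - \<mu> t) = 2 * of_nat m / (of_nat m - 2)"
      using st m by (simp add: S\<mu> field_simps)
    also have "\<dots> = of_nat k" unfolding k using m by simp
    finally have "2 * inverse (1 - \<mu> s - \<mu> t) \<in> \<int>" by simp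
    then show "if s \<in> S \<and> t \<in> S then 2 * inverse (1 - \<mu> s - \<mu> t) \<in> \<int>
        else inverse (1 - \<mu> s - \<mu> t) \<in> \<int>" using st by simp
  qed
  have "S \<noteq> {}" using cardS d ge2 by auto
  then have lcd: "lowest_common_denominator S \<mu> = m"
    using S\<mu> ge2 by (intro lowest_common_denominator_const) auto
  have "nonconstant_map \<pi>"
  proof -
    have "coprime P h"
      using no_common' nz P_roots by (intro coprimeI_no_common_root) (auto simp: P_def)
    then show ?thesis using d ge2 mdeg by (simp add: \<pi>_def)
  qed
  moreover have G: "uniform_ramification \<pi> (Pt 0) a" "uniform_ramification \<pi> (Pt 1) b"
    "uniform_ramification \<pi> Infty 1"
    using ram0 ram1 ramI by (auto simp: uniform_ramification_def fibre_def)
  moreover have "property_G \<pi> T" using G by (auto simp: property_G_def T_def)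
  moreover have "\<forall>t\<in>T. 0 < \<nu> t \<and> \<nu> t < 1" using ge2 by (auto simp: T_def \<nu>)
  moreover have "(\<Sum>t\<in>T. \<nu> t) = 1" using sum1 d by (simp add: T_def \<nu>)
  moreover have "ring_condition R S \<mu>" using ring by (simp add: ring_condition_def lcd)
  ultimately have "pullback_assumptions R \<pi> T \<nu>"
    using Sigma sumS
    unfolding pullback_assumptions_def Let_def \<mu>_def[symmetric] sing nonint_pts
    by (auto simp: T_def S_def)
  then show ?thesis
    unfolding admissible_triple_def using mdeg G \<nu> d by (intro exI[of _ \<pi>] exI[of _ T] exI[of _ \<nu>]) simp
qed

section \<open>The five triples\<close>

lemma admissible_3_2_12:
  assumes "\<And>A. R A A"
  shows "admissible_triple R 3 2 12"
proof (rule admissible_tripleI[where m = 6])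
  let ?p = "[:0, 2, 0, 0, 1:] :: complex poly" and ?q = "[:4, 0, 0, 1, 0, 0, 3:] :: complex poly"
  \<comment> \<open>The coefficients of \<open>q\<close> are chosen so that in \<open>p ^ 3 - q ^ 2\<close> the terms in \<open>z ^ 3\<close> and \<open>z ^ 9\<close> cancel.\<close>
  let ?h = "[:-16, 0, 0, 0, 0, 0, -13, 0, 0, 0, 0, 0, -8:] :: complex poly"
  show "?h = ?p ^ 3 - ?q ^ 2" by (simp add: power2_eq_square power3_eq_cube)
  show "rsquarefree ?p"
    unfolding rsquarefree_roots by (simp add: pderiv_pCons) algebra
  show "rsquarefree ?q"
    unfolding rsquarefree_roots by (simp add: pderiv_pCons) algebra
  show "rsquarefree ?h"
    unfolding rsquarefree_roots
  proof (intro allI notI)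
    fix z assume z: "poly ?h z = 0 \<and> poly (pderiv ?h) z = 0"
    \<comment> \<open>A multiple root would have \<open>u = 0\<close> or make \<open>u\<close> a
      double root of \<open>8 * u\<^sup>2 + 13 * u + 16\<close>, whose discriminant is -343.\<close>
    define u where "u = z ^ 6"
    have "8 * u\<^sup>2 + 13 * u + 16 = - poly ?h z" by (simp add: u_def power2_eq_square algebra_simps eval_nat_numeral)
    with z have 1: "8 * u\<^sup>2 + 13 * u + 16 = 0" by (simp only: minus_zero)
    have "z * poly (pderiv ?h) z = - 6 * u * (16 * u + 13)"
      by (simp add: pderiv_pCons u_def algebra_simps eval_nat_numeral)
    then have "u * (16 * u + 13) = 0" using z by simp
    with 1 show False by algebra
  qed
  show "poly ?q z \<noteq> 0" if "poly ?p z = 0" for z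
    using that by simp algebra
qed (use assms in \<open>simp_all add: ring_of_integers_cyclotomic_6\<close>)

lemma admissible_4_2_8:
  assumes "\<And>A. R A A"
  shows "admissible_triple R 4 2 8"
proof (rule admissible_tripleI[where m = 4])
  let ?p = "[:1, 0, 1:] :: complex poly" and ?q = "[:2, 0, 2, 0, 3:] :: complex poly"
  let ?h = "[:-3, 0, -4, 0, -10, 0, -8, 0, -8:] :: complex poly"
  show "?h = ?p ^ 4 - ?q ^ 2" by (simp add: power2_eq_square power4_eq_xxxx)
  show "rsquarefree ?p"
    unfolding rsquarefree_roots by (simp add: pderiv_pCons) algebra
  show "rsquarefree ?q"
    unfolding rsquarefree_roots by (simp add: pderiv_pCons) algebra
  show "rsquarefree ?h"
    unfolding rsquarefree_roots
  proof (intro allI notI)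
    fix z assume z: "poly ?h z = 0 \<and> poly (pderiv ?h) z = 0"
    \<comment> \<open>As \<open>h\<close> is a quartic in \<open>u\<close>, its derivative times
      \<open>z\<close> is \<open>2 * u\<close> times the derivative of that quartic. A multiple root
      thus has \<open>u = 0\<close> or gives a double root of the quartic.\<close>
    define u where "u = z\<^sup>2"
    have "8 * u ^ 4 + 8 * u ^ 3 + 10 * u\<^sup>2 + 4 * u + 3 = - poly ?h z"
      by (simp add: u_def algebra_simps eval_nat_numeral)
    with z have 1: "8 * u ^ 4 + 8 * u ^ 3 + 10 * u\<^sup>2 + 4 * u + 3 = 0" by (simp only: minus_zero)
    have "z * poly (pderiv ?h) z = - 2 * (u * (32 * u ^ 3 + 24 * u\<^sup>2 + 20 * u + 4))"
      by (simp add: pderiv_pCons u_def algebra_simps eval_nat_numeral)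
    then have "u = 0 \<or> 32 * u ^ 3 + 24 * u\<^sup>2 + 20 * u + 4 = 0" using z by auto
    with 1 show False by (elim disjE; algebra)
  qed
  show "poly ?q z \<noteq> 0" if "poly ?p z = 0" for z
    using that by simp algebra
qed (use assms in \<open>simp_all add: ring_of_integers_cyclotomic_4\<close>)

text \<open>Here \<open>h = - (3 * z ^ 3 + 1) * (z ^ 3 + 1)\<close>, which has six distinct
  roots.\<close>

lemma admissible_6_2_6:
  assumes "\<And>A. R A A"
  shows "admissible_triple R 6 2 6"
proof (rule admissible_tripleI[where m = 3])
  let ?p = "[:0, 1:] :: complex poly" and ?q = "[:1, 0, 0, 2:] :: complex poly"
  let ?h = "[:-1, 0, 0, -4, 0, 0, -3:] :: complex poly"
  show "?h = ?p ^ 6 - ?q ^ 2" by (simp add: eval_nat_numeral)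
  show "rsquarefree ?p" unfolding rsquarefree_roots by (simp add: pderiv_pCons)
  show "rsquarefree ?q"
    unfolding rsquarefree_roots by (simp add: pderiv_pCons) algebra
  show "rsquarefree ?h"
    unfolding rsquarefree_roots by (simp add: pderiv_pCons) algebra
  show "poly ?q z \<noteq> 0" if "poly ?p z = 0" for z
    using that by simp
qed (use assms in \<open>simp_all add: ring_of_integers_cyclotomic_3\<close>)

text \<open>With \<open>u = z\<^sup>2\<close>, \<open>h = (2 - u) * (7 * u\<^sup>2 - u + 1)\<close>;
  its three roots in \<open>u\<close> are distinct and nonzero, so \<open>h\<close> has six distinct
  roots.\<close>

lemma admissible_3_3_6:
  assumes "\<And>A. R A A"
  shows "admissible_triple R 3 3 6"
proof (rule admissible_tripleI[where m = 3])
  let ?p = "[:1, 0, 1:] :: complex poly" and ?q = "[:-1, 0, 2:] :: complex poly"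
  let ?h = "[:2, 0, -3, 0, 15, 0, -7:] :: complex poly"
  show "?h = ?p ^ 3 - ?q ^ 3" by (simp add: power3_eq_cube)
  show "rsquarefree ?p"
    unfolding rsquarefree_roots by (simp add: pderiv_pCons) algebra
  show "rsquarefree ?q"
    unfolding rsquarefree_roots by (simp add: pderiv_pCons) algebra
  show "rsquarefree ?h"
    unfolding rsquarefree_roots by (simp add: pderiv_pCons) algebra
  show "poly ?q z \<noteq> 0" if "poly ?p z = 0" for z
    using that by simp algebra
qed (use assms in \<open>simp_all add: ring_of_integers_cyclotomic_3\<close>)

text \<open>The roots of \<open>h\<close> solve \<open>z = \<zeta> * (2 * z + 1)\<close> for the
  four fourth roots of unity \<open>\<zeta>\<close>, hence are distinct.\<close>

lemma admissible_4_4_4: "admissible_triple (\<subseteq>) 4 4 4"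
proof (rule admissible_tripleI[where m = 2])
  let ?p = "[:0, 1:] :: complex poly" and ?q = "[:1, 2:] :: complex poly"
  let ?h = "[:-1, -8, -24, -32, -15:] :: complex poly"
  show "?h = ?p ^ 4 - ?q ^ 4" by (simp add: power4_eq_xxxx)
  show "rsquarefree ?p" unfolding rsquarefree_roots by (simp add: pderiv_pCons)
  show "rsquarefree ?q" unfolding rsquarefree_roots by (simp add: pderiv_pCons)
  show "rsquarefree ?h"
    unfolding rsquarefree_roots by (simp add: pderiv_pCons) algebra
  show "poly ?q z \<noteq> 0" if "poly ?p z = 0" for z
    using that by simp
  have "ring_of_integers (cyclotomic_field 2) \<subseteq> gaussian_integers"
  proof
    fix x assume "x \<in> ring_of_integers (cyclotomic_field 2)"
    then obtain n where "x = of_int n + of_int 0 * \<i>"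
      using ring_of_integers_cyclotomic_2 by (auto elim!: Ints_cases)
    then show "x \<in> gaussian_integers" unfolding gaussian_integers_eq by blast
  qed
  then show "ring_of_integers (cyclotomic_field 2) \<subseteq> gaussian_integers \<or>
    ring_of_integers (cyclotomic_field 2) \<subseteq> eisenstein_integers" ..
qed simp_all

section \<open>The excluded triple and the classification\<close>

lemma not_admissible_4_4_4: "\<not> admissible_triple (=) 4 4 4"
proof
  assume "admissible_triple (=) 4 4 4"
  then obtain \<pi> T \<nu> where pa: "pullback_assumptions (=) \<pi> T \<nu>" and \<nu>: "\<nu> Infty = 1 / 2"
    by (auto simp: admissible_triple_def)
  define S where "S = fibre \<pi> Infty"
  define \<mu> where "\<mu> = pullback_data \<pi> \<nu>"
  have ring: "ring_condition (=) S \<mu>" and w: "weights S \<mu>"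
    using pa by (auto simp: pullback_assumptions_def Let_def S_def \<mu>_def cond_INT_def cond_Sigma_INT_def)
  have half: "\<mu> s = 1 / of_nat 2" if "s \<in> S" for s
  proof -
    have "\<mu> s = of_nat (ram_index \<pi> s) / 2"
      using that by (simp add: \<mu>_def pullback_data_def S_def fibre_def \<nu>)
    moreover have "0 < \<mu> s" "\<mu> s < 1" using w that by (auto simp: weights_def)
    \<comment> \<open>The weight is half the ramification index and lies strictly between 0 and 1,
      so any such covering is unramified over infinity.\<close>
    ultimately have "0 < ram_index \<pi> s" "ram_index \<pi> s < 2" by (simp_all add: field_simps)
    then have "ram_index \<pi> s = 1" by linarith
    with \<open>\<mu> s = of_nat (ram_index \<pi> s) / 2\<close> show ?thesis by simp
  qed
  moreover have "S \<noteq> {}" using w by (auto simp: weights_def)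
  ultimately have "lowest_common_denominator S \<mu> = 2"
    by (intro lowest_common_denominator_const) auto
  \<comment> \<open>Equality with either ring would place its nonreal generator among the
    integers.\<close>
  then have "gaussian_integers \<subseteq> \<int> \<or> eisenstein_integers \<subseteq> \<int>"
    using ring ring_of_integers_cyclotomic_2 by (auto simp: ring_condition_def Let_def)
  moreover have "\<i> \<in> gaussian_integers"
    by (simp add: gaussian_integers_def self_in_Z_adjoin)
  moreover have "cis (2 * pi / 3) \<in> eisenstein_integers"
    by (simp add: eisenstein_integers_def self_in_Z_adjoin)
  ultimately have "\<i> \<in> \<int> \<or> cis (2 * pi / 3) \<in> \<int>" by blast
  moreover have "x \<in> \<real>" if "x \<in> \<int>" for x :: complex
    using that by (auto elim: Ints_cases)
  ultimately have "\<i> \<in> \<real> \<or> cis (2 * pi / 3) \<in> \<real>" by blast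
  then show False using omega_not_real by (simp add: complex_is_Real_iff)
qed

text \<open>Keeping \<open>R\<close> arbitrary lets one argument serve both readings of the ring
  condition.\<close>

lemma admissible_triple_cases:
  assumes "b \<le> a" "admissible_triple R a b d"
  shows "(a, b, d) \<in> {(3, 2, 12), (4, 2, 8), (6, 2, 6), (3, 3, 6), (4, 4, 4)}"
proof -
  obtain \<pi> T \<nu> where pa: "pullback_assumptions R \<pi> T \<nu>" and deg: "map_degree \<pi> = d"
    and ram: "uniform_ramification \<pi> (Pt 0) a"
    and \<nu>: "\<nu> (Pt 0) = 1 / of_nat a" "\<nu> (Pt 1) = 1 / of_nat b" "\<nu> Infty = 2 / of_nat d"
    using assms(2) by (auto simp: admissible_triple_def)
  have nc: "nonconstant_map \<pi>" and T: "T = {Pt 0, Pt 1, Infty}"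
    and pos: "\<forall>t\<in>T. 0 < \<nu> t \<and> \<nu> t < 1" and sum: "(\<Sum>t\<in>T. \<nu> t) = 1"
    using pa unfolding pullback_assumptions_def by blast+
  show ?thesis
  proof (rule triple_cases[OF assms(1)])
    show "a dvd d" using uniform_ramification_dvd_degree[OF nc ram] deg by simp
    have "0 < 1 / rat_of_nat b" "1 / rat_of_nat b < 1" "0 < 2 / rat_of_nat d"
      using pos unfolding T by (simp_all flip: \<nu>)
    \<comment> \<open>Division by 0 yields 0, so positive exponents exclude \<open>b = 0\<close> and
      \<open>d = 0\<close>; the upper bound excludes \<open>b = 1\<close>.\<close>
    then show "2 \<le> b" "0 < d" by (auto simp: field_simps intro: Nat.gr0I)
    show "1 / of_nat a + 1 / of_nat b + 2 / of_nat d = (1::rat)"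
      using sum unfolding T by (simp add: \<nu>)
  qed
qed

theorem corollary11:
  shows "{(a, b, d). b \<le> a \<and> admissible_triple (\<subseteq>) a b d} =
           {(3, 2, 12), (4, 2, 8), (6, 2, 6), (3, 3, 6), (4, 4, 4)} \<and>
         {(a, b, d). b \<le> a \<and> admissible_triple (=) a b d} =
           {(3, 2, 12), (4, 2, 8), (6, 2, 6), (3, 3, 6)}"
proof (intro conjI equalityI subsetI)
  fix x assume "x \<in> {(a, b, d). b \<le> a \<and> admissible_triple (\<subseteq>) a b d}"
  then show "x \<in> {(3, 2, 12), (4, 2, 8), (6, 2, 6), (3, 3, 6), (4, 4, 4)}"
    using admissible_triple_cases by blast
next
  fix x :: "nat \<times> nat \<times> nat"
  assume "x \<in> {(3, 2, 12), (4, 2, 8), (6, 2, 6), (3, 3, 6), (4, 4, 4)}"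
  then show "x \<in> {(a, b, d). b \<le> a \<and> admissible_triple (\<subseteq>) a b d}"
    using admissible_3_2_12[of "(\<subseteq>)"] admissible_4_2_8[of "(\<subseteq>)"] admissible_6_2_6[of "(\<subseteq>)"]
      admissible_3_3_6[of "(\<subseteq>)"] admissible_4_4_4 by auto
next
  fix x assume x: "x \<in> {(a, b, d). b \<le> a \<and> admissible_triple (=) a b d}"
  then have "x \<in> {(3, 2, 12), (4, 2, 8), (6, 2, 6), (3, 3, 6), (4, 4, 4)}"
    using admissible_triple_cases by blast
  with x not_admissible_4_4_4 show "x \<in> {(3, 2, 12), (4, 2, 8), (6, 2, 6), (3, 3, 6)}"
    by auto
next
  fix x :: "nat \<times> nat \<times> nat"
  assume "x \<in> {(3, 2, 12), (4, 2, 8), (6, 2, 6), (3, 3, 6)}"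
  then show "x \<in> {(a, b, d). b \<le> a \<and> admissible_triple (=) a b d}"
    using admissible_3_2_12[of "(=)"] admissible_4_2_8[of "(=)"] admissible_6_2_6[of "(=)"]
      admissible_3_3_6[of "(=)"] by auto
qed

end
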